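(* Let $d:\mathbb Z\to\mathbb Z$ be an anti-symmetric function with $d(1)=1$. The group $G_d$ is residually finite if and only if $d \bmod q$ is periodic for infinitely many positive integers $q$.
   Context: Anti-symmetric means $d(-i)=-d(i)$ for all $i\in\mathbb Z$. $G_d$ is the group with generators $t$, $a_i$, $c_i$ ($i\in\mathbb Z$) and relations, for all $i,j\in\mathbb Z$: $ta_it^{-1}=a_{i+1}$, $tc_it^{-1}=c_i$, $[a_i,a_j]=c_{i-j}$, $[c_i,a_j]=[c_i,c_j]=1$, $c_i=c_1^{d(i)}$, where $[x,y]=xyx^{-1}y^{-1}$. "$d\bmod q$ is periodic" means there is an integer $I\ge1$ with $d(n+I)\equiv d(n)\pmod q$ for all $n\in\mathbb Z$. A group is residually finite if every non-trivial element has non-trivial image in some finite quotient. *)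

theory Defs
  imports "HOL-Algebra.Coset" "HOL-Number_Theory.Cong"
begin

section \<open>Groups given by generators and relations\<close>

text \<open>
  A word is a list of letters; the letter \<open>(True, x)\<close> stands for the generator \<open>x\<close> and
  \<open>(False, x)\<close> for its formal inverse. Words need not be freely reduced: free reduction is
  part of the congruence by which we divide.
\<close>

type_synonym 'g word = "(bool \<times> 'g) list"

definition gen :: "'g \<Rightarrow> 'g word"
  where "gen x = [(True, x)]"

definition word_inv :: "'g word \<Rightarrow> 'g word"
  where "word_inv w = rev (map (\<lambda>(b, x). (\<not> b, x)) w)"

definition word_pow :: "'g word \<Rightarrow> int \<Rightarrow> 'g word"
  where "word_pow w k =
    (if 0 \<le> k then concat (replicate (nat k) w) else concat (replicate (nat (- k)) (word_inv w)))"

definition word_comm :: "'g word \<Rightarrow> 'g word \<Rightarrow> 'g word"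
  where "word_comm u v = u @ v @ word_inv u @ word_inv v"

text \<open>
  A pair \<open>(u, v)\<close> in \<open>R\<close> is the relation \<open>u = v\<close>. The predicate below is the least congruence on
  the free monoid of words that contains \<open>R\<close> and the free cancellations.
\<close>

inductive word_eq :: "('g word \<times> 'g word) set \<Rightarrow> 'g word \<Rightarrow> 'g word \<Rightarrow> bool"
  for R :: "('g word \<times> 'g word) set"
  where
    relation: "(u, v) \<in> R \<Longrightarrow> word_eq R u v"
  | cancel: "word_eq R [(b, x), (\<not> b, x)] []"
  | refl: "word_eq R u u"
  | sym: "word_eq R u v \<Longrightarrow> word_eq R v u"
  | trans: "word_eq R u v \<Longrightarrow> word_eq R v w \<Longrightarrow> word_eq R u w"
  | append: "word_eq R u v \<Longrightarrow> word_eq R u' v' \<Longrightarrow> word_eq R (u @ u') (v @ v')"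

definition word_class :: "('g word \<times> 'g word) set \<Rightarrow> 'g word \<Rightarrow> 'g word set"
  where "word_class R u = {v. word_eq R u v}"

text \<open>All elements of the type \<open>'g\<close> are generators.\<close>

definition presented_group :: "('g word \<times> 'g word) set \<Rightarrow> 'g word set monoid"
  where "presented_group R =
    \<lparr>carrier = range (word_class R),
     monoid.mult = (\<lambda>A B. \<Union>u\<in>A. \<Union>v\<in>B. word_class R (u @ v)),
     one = word_class R []\<rparr>"

lemma word_class_eq_iff: "word_class R u = word_class R v \<longleftrightarrow> word_eq R u v"
  unfolding word_class_def
  by (metis (no_types, lifting) Collect_cong mem_Collect_eq word_eq.refl word_eq.sym word_eq.trans)

lemma carrier_presented_group: "carrier (presented_group R) = range (word_class R)"
  by (simp add: presented_group_def)

lemma one_presented_group: "\<one>\<^bsub>presented_group R\<^esub> = word_class R []"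
  by (simp add: presented_group_def)

lemma mult_presented_group:
  "word_class R u \<otimes>\<^bsub>presented_group R\<^esub> word_class R v = word_class R (u @ v)"
proof -
  have "word_class R (u' @ v') = word_class R (u @ v)"
    if "u' \<in> word_class R u" "v' \<in> word_class R v" for u' v'
    unfolding word_class_eq_iff
  proof (rule word_eq.sym, rule word_eq.append)
    show "word_eq R u u'" "word_eq R v v'"
      using that by (simp_all add: word_class_def)
  qed
  moreover have "u \<in> word_class R u" "v \<in> word_class R v"
    by (simp_all add: word_class_def word_eq.refl)
  ultimately have
    "(\<Union>u'\<in>word_class R u. \<Union>v'\<in>word_class R v. word_class R (u' @ v')) = word_class R (u @ v)"
    by blast
  then show ?thesis
    by (simp add: presented_group_def)
qed

lemma word_eq_inv_append: "word_eq R (word_inv w @ w) []"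
proof (induction w)
  case Nil
  show ?case by (simp add: word_inv_def word_eq.refl)
next
  case (Cons l w)
  obtain b x where l: "l = (b, x)" by (cases l)
  have "word_eq R ([(\<not> b, x), (b, x)] @ w) ([] @ w)"
    using word_eq.append[OF word_eq.cancel[of R "\<not> b" x] word_eq.refl[of R w]] by simp
  then have "word_eq R (word_inv w @ ([(\<not> b, x), (b, x)] @ w)) (word_inv w @ w)"
    using word_eq.append[OF word_eq.refl[of R "word_inv w"]] by simp
  from word_eq.trans[OF this Cons.IH] show ?case
    by (simp add: l word_inv_def)
qed

lemma group_presented_group: "group (presented_group R)"
proof (rule groupI)
  fix x assume "x \<in> carrier (presented_group R)"
  then obtain w where w: "x = word_class R w"
    by (auto simp: carrier_presented_group)
  have "word_class R (word_inv w) \<otimes>\<^bsub>presented_group R\<^esub> x = \<one>\<^bsub>presented_group R\<^esub>"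
    by (simp add: w mult_presented_group one_presented_group word_class_eq_iff word_eq_inv_append)
  then show "\<exists>y\<in>carrier (presented_group R). y \<otimes>\<^bsub>presented_group R\<^esub> x = \<one>\<^bsub>presented_group R\<^esub>"
    by (auto simp: carrier_presented_group)
qed (auto simp: carrier_presented_group one_presented_group mult_presented_group)


section \<open>Residual finiteness\<close>

text \<open>\<open>N #>\<^bsub>G\<^esub> x\<close> is the image of \<open>x\<close> under the quotient map from \<open>G\<close> to \<open>G Mod N\<close>.\<close>

definition residually_finite :: "('a, 'b) monoid_scheme \<Rightarrow> bool"
  where "residually_finite G \<longleftrightarrow>
    (\<forall>x\<in>carrier G. x \<noteq> \<one>\<^bsub>G\<^esub> \<longrightarrow>
      (\<exists>N. N \<lhd> G \<and> finite (carrier (G Mod N)) \<and> N #>\<^bsub>G\<^esub> x \<noteq> \<one>\<^bsub>G Mod N\<^esub>))"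


section \<open>The groups \<open>G\<^sub>d\<close>\<close>

datatype gd_gen = gen_t | gen_a int | gen_c int

abbreviation t_word :: "gd_gen word" where "t_word \<equiv> gen gen_t"
abbreviation a_word :: "int \<Rightarrow> gd_gen word" where "a_word i \<equiv> gen (gen_a i)"
abbreviation c_word :: "int \<Rightarrow> gd_gen word" where "c_word i \<equiv> gen (gen_c i)"

definition gd_relations :: "(int \<Rightarrow> int) \<Rightarrow> (gd_gen word \<times> gd_gen word) set"
  where "gd_relations d =
      {(t_word @ a_word i @ word_inv t_word, a_word (i + 1)) | i. True}
    \<union> {(t_word @ c_word i @ word_inv t_word, c_word i) | i. True}
    \<union> {(word_comm (a_word i) (a_word j), c_word (i - j)) | i j. True}
    \<union> {(word_comm (c_word i) (a_word j), []) | i j. True}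
    \<union> {(word_comm (c_word i) (c_word j), []) | i j. True}
    \<union> {(c_word i, word_pow (c_word 1) (d i)) | i. True}"

definition G_d :: "(int \<Rightarrow> int) \<Rightarrow> gd_gen word set monoid"
  where "G_d d = presented_group (gd_relations d)"


section \<open>Periodicity modulo \<open>q\<close>\<close>

definition periodic_mod :: "(int \<Rightarrow> int) \<Rightarrow> int \<Rightarrow> bool"
  where "periodic_mod d q \<longleftrightarrow> (\<exists>I\<ge>1. \<forall>n. [d (n + I) = d n] (mod q))"

end

theory Submission
  imports Defs "HOL-Algebra.Bij" "HOL-Algebra.Multiplicative_Group"
begin

text \<open>
  Write \<open>c = c\<^sub>1\<close>. This element is central in \<open>G\<^sub>d\<close>, and the quotient of \<open>G\<^sub>d\<close> by it is the wreath product
  \<open>\<int> \<wr> \<int>\<close>, in which the \<open>a\<^sub>i\<close> are free commuting generators shifted by \<open>t\<close>. The function \<open>d\<close> records the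
  commutators: \<open>[a\<^sub>i, a\<^sub>j] = c\<close> to the power \<open>d (i - j)\<close>.

  In a finite quotient, \<open>t\<close> has a finite order \<open>I\<close>, so \<open>a\<^sub>i\<close> depends only on \<open>i mod I\<close>, and comparing
  commutators with \<open>a\<^sub>0\<close> shows that \<open>d\<close> has the period \<open>I\<close> modulo the order of \<open>c\<close>
  (\<open>periodic_mod_ord_c\<close>). As \<open>c\<close> has infinite order in \<open>G\<^sub>d\<close> (\<open>c_power_nontrivial\<close>), residual finiteness
  provides quotients in which the order of \<open>c\<close> does not divide a prescribed \<open>m \<noteq> 0\<close>; hence finitely
  many moduli cannot suffice.

  For the converse one needs finite quotients. They all come from one family of actions
  (\<open>gd_action\<close>) on pairs of a periodic function \<open>u\<close> modulo \<open>q\<close> and a residue \<open>z\<close> modulo \<open>q\<close>. One member of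
  this family detects powers of \<open>c\<close> and exists if \<open>d\<close> is periodic modulo \<open>q\<close>; another one factors
  through a finite lamplighter group, exists for all \<open>q\<close> and \<open>I\<close>, and detects the exponent of \<open>t\<close> and
  the exponent sums of the \<open>a\<^sub>i\<close>. Now let \<open>x\<close> be trivial in every finite quotient. By \<open>normal_form\<close>,
  \<open>x\<close> is the product of a word \<open>L\<close> in the \<open>a\<^sub>i\<close>, a power of \<open>t\<close> and a power of \<open>c\<close>. The lamplighter groups
  show that \<open>t\<close> does not occur and that all exponent sums of \<open>L\<close> vanish; then \<open>L\<close> is a power of \<open>c\<close>
  (\<open>balanced_word_in_c\<close>), and so is \<open>x\<close>. With moduli \<open>q\<close> as large as desired, the first kind of action
  shows that \<open>x\<close> is trivial (\<open>finite_residual_c_power\<close>).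
\<close>

section \<open>Evaluating words in a group\<close>
definition letter_val :: "('h, 'k) monoid_scheme \<Rightarrow> ('g \<Rightarrow> 'h) \<Rightarrow> bool \<times> 'g \<Rightarrow> 'h"
  where "letter_val H f l = (if fst l then f (snd l) else inv\<^bsub>H\<^esub> f (snd l))"

primrec word_val :: "('h, 'k) monoid_scheme \<Rightarrow> ('g \<Rightarrow> 'h) \<Rightarrow> 'g word \<Rightarrow> 'h"
  where
    "word_val H f [] = \<one>\<^bsub>H\<^esub>"
  | "word_val H f (l # w) = letter_val H f l \<otimes>\<^bsub>H\<^esub> word_val H f w"

context group
begin

lemma letter_val_closed [simp]: "range f \<subseteq> carrier G \<Longrightarrow> letter_val G f l \<in> carrier G"
  by (simp add: letter_val_def range_subsetD)

lemma word_val_closed [simp]: "range f \<subseteq> carrier G \<Longrightarrow> word_val G f w \<in> carrier G"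
  by (induction w) simp_all

lemma word_val_append:
  "range f \<subseteq> carrier G \<Longrightarrow> word_val G f (u @ v) = word_val G f u \<otimes> word_val G f v"
  by (induction u) (simp_all add: m_assoc)

lemma word_val_gen [simp]: "range f \<subseteq> carrier G \<Longrightarrow> word_val G f (gen x) = f x"
  by (simp add: gen_def letter_val_def range_subsetD)

lemma letter_val_not:
  "range f \<subseteq> carrier G \<Longrightarrow> letter_val G f (\<not> b, x) = inv (letter_val G f (b, x))"
  by (simp add: letter_val_def range_subsetD)

lemma word_val_inv:
  assumes "range f \<subseteq> carrier G"
  shows "word_val G f (word_inv w) = inv (word_val G f w)"
proof (induction w)
  case Nil
  then show ?case by (simp add: word_inv_def)
next
  case (Cons l w)
  obtain b x where l: "l = (b, x)" by (cases l)
  have "word_inv (l # w) = word_inv w @ [(\<not> b, x)]"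
    by (simp add: word_inv_def l)
  then show ?case
    using assms by (simp add: word_val_append Cons.IH l letter_val_not inv_mult_group)
qed

lemma word_val_pow:
  assumes "range f \<subseteq> carrier G"
  shows "word_val G f (word_pow w k) = word_val G f w [^] k"
proof -
  have replicate: "word_val G f (concat (replicate n u)) = word_val G f u [^] n" for n :: nat and u
  proof (induction n)
    case (Suc n)
    then show ?case
      using assms nat_pow_Suc2[of "word_val G f u" n] by (simp add: word_val_append)
  qed simp
  show ?thesis
    unfolding word_pow_def int_pow_def2 using assms
    by (simp add: replicate word_val_inv int_pow_inv)
qed

lemma word_val_comm:
  assumes "range f \<subseteq> carrier G"
  shows "word_val G f (word_comm u v) =
    word_val G f u \<otimes> word_val G f v \<otimes> inv (word_val G f u) \<otimes> inv (word_val G f v)"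
  using assms by (simp add: word_comm_def word_val_append word_val_inv m_assoc)

lemma word_val_respects_word_eq:
  assumes f: "range f \<subseteq> carrier G"
    and R: "\<And>u v. (u, v) \<in> R \<Longrightarrow> word_val G f u = word_val G f v"
    and "word_eq R u v"
  shows "word_val G f u = word_val G f v"
  using \<open>word_eq R u v\<close>
proof induction
  case (relation u v)
  then show ?case by (rule R)
next
  case (cancel b x)
  then show ?case
    using f by (simp add: letter_val_not)
next
  case (append u v u' v')
  then show ?case
    using f by (simp add: word_val_append)
qed simp_all

text \<open>
  Von Dyck's theorem: an assignment of the generators that respects the relations extends to
  the presented group.
\<close>
lemma presented_group_lift:
  assumes f: "range f \<subseteq> carrier G"
    and R: "\<And>u v. (u, v) \<in> R \<Longrightarrow> word_val G f u = word_val G f v"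
  shows "\<exists>h\<in>hom (presented_group R) G. \<forall>w. h (word_class R w) = word_val G f w"
proof (intro bexI allI)
  define h where "h X = word_val G f (SOME w. X = word_class R w)" for X
  show h: "h (word_class R w) = word_val G f w" for w
  proof -
    have "word_class R w = word_class R (SOME v. word_class R w = word_class R v)"
      by (rule someI) simp
    then have "word_eq R w (SOME v. word_class R w = word_class R v)"
      by (simp only: word_class_eq_iff)
    from word_val_respects_word_eq[OF f R this] show ?thesis
      by (simp add: h_def)
  qed
  show "h \<in> hom (presented_group R) G"
    using f by (auto simp: hom_def carrier_presented_group mult_presented_group h word_val_append)
qed

end

text \<open>
  The class of a word is its own value in the presented group, so that facts about values of words
  apply to the presented group itself.
\<close>
lemma word_class_eq_word_val:
  "word_class R w = word_val (presented_group R) (\<lambda>x. word_class R (gen x)) w"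
proof (induction w)
  case Nil
  show ?case by (simp add: one_presented_group)
next
  case (Cons l w)
  interpret P: group "presented_group R" by (rule group_presented_group)
  obtain b x where l: "l = (b, x)" by (cases l)
  have closed: "word_class R v \<in> carrier (presented_group R)" for v
    by (simp add: carrier_presented_group)
  have "word_class R [(False, x)] \<otimes>\<^bsub>presented_group R\<^esub> word_class R (gen x)
      = \<one>\<^bsub>presented_group R\<^esub>"
    using word_eq.cancel[of R False x]
    by (simp add: mult_presented_group one_presented_group word_class_eq_iff gen_def)
  then have "inv\<^bsub>presented_group R\<^esub> (word_class R (gen x)) = word_class R [(False, x)]"
    using closed by (intro P.inv_equality) auto
  then have "letter_val (presented_group R) (\<lambda>x. word_class R (gen x)) l = word_class R [l]"
    by (simp add: letter_val_def l gen_def)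
  then show ?case
    by (simp add: Cons.IH[symmetric] mult_presented_group)
qed

lemma hom_word_val:
  assumes "h \<in> hom G H" "group G" "group H" "range f \<subseteq> carrier G"
  shows "h (word_val G f w) = word_val H (h \<circ> f) w"
proof -
  interpret group_hom G H h
    using assms by (simp add: group_hom_def group_hom_axioms_def)
  have "h (letter_val G f l) = letter_val H (h \<circ> f) l" for l
    using assms(4) by (auto simp: letter_val_def image_subset_iff)
  then show ?thesis
    using assms(4) by (induction w) simp_all
qed

section \<open>Groups that satisfy the relations of \<open>G\<^sub>d\<close>\<close>

text \<open>
  The relations are stated without inverses, which is the form in which they can be checked for
  permutations given by explicit formulas; \<open>gd_system_iff\<close> translates back to words.
\<close>
locale gd_system = group +
  fixes t :: 'a and a c :: "int \<Rightarrow> 'a" and d :: "int \<Rightarrow> int"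
  assumes t_closed [simp]: "t \<in> carrier G"
    and a_closed [simp]: "a i \<in> carrier G"
    and c_closed [simp]: "c i \<in> carrier G"
    and t_a: "t \<otimes> a i = a (i + 1) \<otimes> t"
    and t_c: "t \<otimes> c i = c i \<otimes> t"
    and a_a: "a i \<otimes> a j = c (i - j) \<otimes> (a j \<otimes> a i)"
    and c_a: "c i \<otimes> a j = a j \<otimes> c i"
    and c_c: "c i \<otimes> c j = c j \<otimes> c i"
    and c_power: "c i = c 1 [^] d i"

abbreviation gd_letters :: "'a \<Rightarrow> (int \<Rightarrow> 'a) \<Rightarrow> (int \<Rightarrow> 'a) \<Rightarrow> gd_gen \<Rightarrow> 'a"
  where "gd_letters t a c \<equiv> case_gd_gen t a c"

lemma range_gd_letters:
  "range (gd_letters t a c) \<subseteq> A \<longleftrightarrow> t \<in> A \<and> range a \<subseteq> A \<and> range c \<subseteq> A"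
  (is "?L \<longleftrightarrow> ?R")
proof
  assume L: ?L
  have "gd_letters t a c x \<in> A" for x
    using L by auto
  from this[of gen_t] this[of "gen_a _"] this[of "gen_c _"] show ?R
    by auto
qed (auto simp: image_subset_iff split: gd_gen.split)

lemma (in group) conj_eq_iff:
  "\<lbrakk>x \<in> carrier G; y \<in> carrier G; z \<in> carrier G\<rbrakk> \<Longrightarrow> x \<otimes> y \<otimes> inv x = z \<longleftrightarrow> x \<otimes> y = z \<otimes> x"
  by (intro inv_solve_right') auto

lemma (in group) comm_eq_iff:
  assumes "x \<in> carrier G" "y \<in> carrier G" "z \<in> carrier G"
  shows "x \<otimes> y \<otimes> inv x \<otimes> inv y = z \<longleftrightarrow> x \<otimes> y = z \<otimes> (y \<otimes> x)"
proof -
  have "x \<otimes> y \<otimes> inv x \<otimes> inv y = z \<longleftrightarrow> x \<otimes> y \<otimes> inv x = z \<otimes> y"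
    using assms by (intro inv_solve_right') auto
  also have "\<dots> \<longleftrightarrow> x \<otimes> y = z \<otimes> y \<otimes> x"
    using assms by (intro inv_solve_right') auto
  finally show ?thesis
    using assms by (simp only: m_assoc)
qed

lemma ball_gd_relations:
  "(\<forall>(u, v)\<in>gd_relations d. P u v) \<longleftrightarrow>
    (\<forall>i. P (t_word @ a_word i @ word_inv t_word) (a_word (i + 1))) \<and>
    (\<forall>i. P (t_word @ c_word i @ word_inv t_word) (c_word i)) \<and>
    (\<forall>i j. P (word_comm (a_word i) (a_word j)) (c_word (i - j))) \<and>
    (\<forall>i j. P (word_comm (c_word i) (a_word j)) []) \<and>
    (\<forall>i j. P (word_comm (c_word i) (c_word j)) []) \<and>
    (\<forall>i. P (c_word i) (word_pow (c_word 1) (d i)))"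
proof -
  have family1: "(\<forall>x\<in>{(f i, g i) | i. True}. Q x) \<longleftrightarrow> (\<forall>i. Q (f i, g i))"
    for f g :: "int \<Rightarrow> gd_gen word" and Q
    by blast
  have family2: "(\<forall>x\<in>{(f i j, g i j) | i j. True}. Q x) \<longleftrightarrow> (\<forall>i j. Q (f i j, g i j))"
    for f g :: "int \<Rightarrow> int \<Rightarrow> gd_gen word" and Q
    by blast
  show ?thesis
    unfolding gd_relations_def ball_Un family1 family2 by (simp add: conj_assoc)
qed

lemma gd_system_iff:
  fixes G (structure)
  shows "gd_system G t a c d \<longleftrightarrow> group G \<and> range (gd_letters t a c) \<subseteq> carrier G \<and>
    (\<forall>(u, v)\<in>gd_relations d. word_val G (gd_letters t a c) u = word_val G (gd_letters t a c) v)"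
proof (cases "group G \<and> range (gd_letters t a c) \<subseteq> carrier G")
  case True
  then interpret group G by simp
  have r: "range (gd_letters t a c) \<subseteq> carrier G"
    using True by simp
  then have [simp]: "t \<in> carrier G" "a i \<in> carrier G" "c i \<in> carrier G" for i
    by (auto simp: range_gd_letters)
  have conj: "word_val G (gd_letters t a c) (t_word @ gen x @ word_inv t_word) = z \<longleftrightarrow>
      t \<otimes> gd_letters t a c x = z \<otimes> t" if "z \<in> carrier G" for x z
    using r that by (simp add: word_val_append word_val_inv conj_eq_iff range_subsetD[OF r] flip: m_assoc)
  have comm: "word_val G (gd_letters t a c) (word_comm (gen x) (gen y))
        = word_val G (gd_letters t a c) w \<longleftrightarrow>
      gd_letters t a c x \<otimes> gd_letters t a c y =
      word_val G (gd_letters t a c) w \<otimes> (gd_letters t a c y \<otimes> gd_letters t a c x)" for x y w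
    using r by (simp add: word_val_comm comm_eq_iff range_subsetD[OF r])
  show ?thesis
    using True
    by (simp add: ball_gd_relations conj comm word_val_pow gd_system_def gd_system_axioms_def)
next
  case False
  then show ?thesis
    by (auto simp: gd_system_def gd_system_axioms_def range_gd_letters)
qed

section \<open>Collecting words modulo powers of \<open>c\<close>\<close>
lemma (in group) word_val_in_subgroup:
  assumes "subgroup S G" "range f \<subseteq> S"
  shows "word_val G f w \<in> S"
  using assms
  by (induction w)
    (simp_all add: letter_val_def subgroup.one_closed subgroup.m_closed subgroup.m_inv_closed range_subsetD)

lemma (in group) mult_inv_cancel:
  assumes "x \<in> carrier G" "y \<in> carrier G"
  shows "inv x \<otimes> (x \<otimes> y) = y" "x \<otimes> (inv x \<otimes> y) = y"
    "y \<otimes> x \<otimes> inv x = y" "y \<otimes> inv x \<otimes> x = y"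
  using assms by (simp_all add: m_assoc) (simp_all flip: m_assoc)

lemma (in group) centralizer_subgroup:
  assumes "z \<in> carrier G"
  shows "subgroup {x \<in> carrier G. x \<otimes> z = z \<otimes> x} G"
proof (rule subgroupI)
  fix x assume "x \<in> {x \<in> carrier G. x \<otimes> z = z \<otimes> x}"
  then have x: "x \<in> carrier G" and xz: "x \<otimes> z = z \<otimes> x"
    by auto
  have "inv x \<otimes> z = inv x \<otimes> (z \<otimes> x) \<otimes> inv x"
    using x assms by (simp add: m_assoc)
  also have "\<dots> = z \<otimes> inv x"
    using x assms by (simp add: mult_inv_cancel flip: xz)
  finally show "inv x \<in> {x \<in> carrier G. x \<otimes> z = z \<otimes> x}"
    using x by simp
next
  fix x y
  assume x: "x \<in> {x \<in> carrier G. x \<otimes> z = z \<otimes> x}" and y: "y \<in> {x \<in> carrier G. x \<otimes> z = z \<otimes> x}"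
  then have "x \<otimes> y \<otimes> z = x \<otimes> (z \<otimes> y)"
    using assms by (simp add: m_assoc)
  also have "\<dots> = z \<otimes> x \<otimes> y"
    using x y assms by (simp flip: m_assoc)
  finally show "x \<otimes> y \<in> {x \<in> carrier G. x \<otimes> z = z \<otimes> x}"
    using x y assms by (simp add: m_assoc)
qed (use assms in auto)

lemma (in group) conjugation_inv:
  assumes "x \<in> carrier G" "y \<in> carrier G" "z \<in> carrier G" "x \<otimes> y = z \<otimes> x"
  shows "x \<otimes> inv y = inv z \<otimes> x"
proof -
  have "x \<otimes> inv y = inv z \<otimes> (z \<otimes> x) \<otimes> inv y"
    using assms(1-3) by (simp add: mult_inv_cancel)
  also have "\<dots> = inv z \<otimes> x"
    using assms(1-3) by (simp add: mult_inv_cancel m_assoc flip: assms(4))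
  finally show ?thesis .
qed

definition word_sum :: "('g \<Rightarrow> int) \<Rightarrow> 'g word \<Rightarrow> int"
  where "word_sum f w = (\<Sum>(b, x)\<leftarrow>w. if b then f x else - f x)"

lemma word_sum_simps [simp]:
  "word_sum f [] = 0"
  "word_sum f ((b, x) # w) = (if b then f x else - f x) + word_sum f w"
  "word_sum f (v @ w) = word_sum f v + word_sum f w"
  by (simp_all add: word_sum_def)

lemma word_sum_cong:
  "(\<And>x. x \<in> snd ` set w \<Longrightarrow> f x = g x) \<Longrightarrow> word_sum f w = word_sum g w"
  by (induction w) (auto split: prod.split)

context gd_system
begin

lemma range_a [simp]: "range a \<subseteq> carrier G"
  by auto

lemma range_letters [simp]: "range (gd_letters t a c) \<subseteq> carrier G"
  by (auto simp: range_gd_letters)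

lemma letter_val_t_power: "letter_val G (gd_letters t a c) (b, gen_t) = t [^] (if b then 1 else - 1 :: int)"
  by (simp add: letter_val_def int_pow_neg)

lemma letter_val_c_power:
  "letter_val G (gd_letters t a c) (b, gen_c i) = c 1 [^] (if b then d i else - d i)"
  using c_power[of i] by (simp add: letter_val_def int_pow_neg)

lemma t_power_a: "t [^] (s :: int) \<otimes> a i = a (i + s) \<otimes> t [^] s"
proof (induction s arbitrary: i rule: int_induct[of _ 0])
  case base
  show ?case by simp
next
  case (step1 s)
  have "t [^] (s + 1) \<otimes> a i = t [^] s \<otimes> (t \<otimes> a i)"
    by (simp add: int_pow_mult m_assoc)
  also have "\<dots> = t [^] s \<otimes> a (i + 1) \<otimes> t"
    by (simp add: t_a m_assoc)
  also have "\<dots> = a (i + 1 + s) \<otimes> t [^] (s + 1)"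
    by (simp add: step1.IH m_assoc int_pow_mult)
  finally show ?case
    by (simp add: algebra_simps)
next
  case (step2 s)
  have "t \<otimes> a (i - 1) = a i \<otimes> t"
    using t_a[of "i - 1"] by simp
  then have "inv t \<otimes> a i = a (i - 1) \<otimes> inv t"
    by (metis a_closed inv_closed m_assoc m_closed mult_inv_cancel(1,3) t_closed)
  then have "t [^] (s - 1) \<otimes> a i = t [^] s \<otimes> a (i - 1) \<otimes> inv t"
    by (simp add: int_pow_diff m_assoc)
  also have "\<dots> = a (i - 1 + s) \<otimes> t [^] (s - 1)"
    by (simp add: step2.IH m_assoc int_pow_diff)
  finally show ?case
    by (simp add: algebra_simps)
qed

lemma t_power_word:
  "t [^] (s :: int) \<otimes> word_val G a L = word_val G a (map (\<lambda>(b, i). (b, i + s)) L) \<otimes> t [^] s"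
proof (induction L)
  case Nil
  show ?case by simp
next
  case (Cons l L)
  obtain b i where l: "l = (b, i)" by (cases l)
  have "t [^] s \<otimes> letter_val G a (b, i) = letter_val G a (b, i + s) \<otimes> t [^] s"
    using t_power_a conjugation_inv[OF _ _ _ t_power_a] by (simp add: letter_val_def)
  then have "t [^] s \<otimes> word_val G a (l # L) =
      letter_val G a (b, i + s) \<otimes> (t [^] s \<otimes> word_val G a L)"
    by (simp add: l flip: m_assoc)
  then show ?case
    by (simp add: l Cons.IH m_assoc)
qed

end

locale gd_generated = gd_system +
  assumes generated: "x \<in> carrier G \<Longrightarrow> \<exists>w. x = word_val G (gd_letters t a c) w"
begin

lemma c_central:
  assumes x: "x \<in> carrier G"
  shows "x \<otimes> c 1 [^] (m :: int) = c 1 [^] m \<otimes> x"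
proof -
  have "range (gd_letters t a c) \<subseteq> {x \<in> carrier G. x \<otimes> c 1 = c 1 \<otimes> x}"
    using t_c c_a c_c by (auto simp: range_gd_letters)
  with generated[OF x] have "x \<otimes> c 1 = c 1 \<otimes> x"
    using word_val_in_subgroup[OF centralizer_subgroup[OF c_closed]] by blast
  then have "c 1 \<in> {z \<in> carrier G. z \<otimes> x = x \<otimes> z}"
    by simp
  then have "c 1 [^] m \<in> {z \<in> carrier G. z \<otimes> x = x \<otimes> z}"
    by (rule subgroup_int_pow_closed[OF centralizer_subgroup[OF x]])
  then show ?thesis by simp
qed

text \<open>
  Powers of \<open>t\<close> move to the right past words in the \<open>a i\<close> by \<open>t_power_word\<close>, and each \<open>c i\<close> is a
  central power of \<open>c 1\<close>. Since the later arguments see \<open>L\<close> only through its exponent sums, its letters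
  are left in the order in which they arise.
\<close>
lemma normal_form:
  assumes "x \<in> carrier G"
  obtains L and k m :: int where "x = word_val G a L \<otimes> t [^] k \<otimes> c 1 [^] m"
proof -
  have "\<exists>L k m. word_val G (gd_letters t a c) w =
      word_val G a L \<otimes> t [^] (k :: int) \<otimes> c 1 [^] (m :: int)" for w
  proof (induction w)
    case Nil
    have "word_val G (gd_letters t a c) [] = word_val G a [] \<otimes> t [^] (0 :: int) \<otimes> c 1 [^] (0 :: int)"
      by simp
    then show ?case by blast
  next
    case (Cons l w)
    then obtain L and k m :: int where IH:
      "word_val G (gd_letters t a c) w = word_val G a L \<otimes> t [^] k \<otimes> c 1 [^] m"
      by blast
    obtain b x where l: "l = (b, x)" by (cases l)
    show ?case
    proof (cases x)
      case gen_t
      define s :: int where "s = (if b then 1 else - 1)"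
      have "word_val G (gd_letters t a c) (l # w) =
          t [^] s \<otimes> word_val G a L \<otimes> t [^] k \<otimes> c 1 [^] m"
        by (simp add: l gen_t letter_val_t_power IH m_assoc s_def)
      also have "\<dots> = word_val G a (map (\<lambda>(b, i). (b, i + s)) L) \<otimes> t [^] (s + k) \<otimes> c 1 [^] m"
        by (simp add: t_power_word int_pow_mult m_assoc)
      finally show ?thesis by blast
    next
      case (gen_a i)
      have "word_val G (gd_letters t a c) (l # w) =
          word_val G a ((b, i) # L) \<otimes> t [^] k \<otimes> c 1 [^] m"
        by (simp add: l gen_a letter_val_def IH m_assoc)
      then show ?thesis by blast
    next
      case (gen_c i)
      define s :: int where "s = (if b then d i else - d i)"
      have "word_val G (gd_letters t a c) (l # w) =
          c 1 [^] s \<otimes> (word_val G a L \<otimes> t [^] k \<otimes> c 1 [^] m)"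
        by (simp add: l gen_c letter_val_c_power IH s_def)
      also have "\<dots> = word_val G a L \<otimes> t [^] k \<otimes> c 1 [^] m \<otimes> c 1 [^] s"
        by (rule c_central[symmetric]) simp
      also have "\<dots> = word_val G a L \<otimes> t [^] k \<otimes> c 1 [^] (m + s)"
        by (simp add: int_pow_mult m_assoc)
      finally show ?thesis by blast
    qed
  qed
  with generated[OF assms] that show thesis by metis
qed

text \<open>
  Commuting with \<open>x\<close> up to a power of the central element \<open>c 1\<close> is commuting modulo the subgroup
  generated by \<open>c 1\<close>; this set is the preimage of a centralizer. It reduces statements about words
  to the single generators \<open>a i\<close>.
\<close>
lemma commuting_mod_c_subgroup:
  assumes x: "x \<in> carrier G"
  shows "subgroup {y \<in> carrier G. \<exists>m :: int. x \<otimes> y = c 1 [^] m \<otimes> (y \<otimes> x)} G" (is "subgroup ?S G")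
proof (rule subgroupI)
  have "x \<otimes> \<one> = c 1 [^] (0 :: int) \<otimes> (\<one> \<otimes> x)"
    using x by simp
  then show "?S \<noteq> {}"
    by blast
next
  fix y assume "y \<in> ?S"
  then obtain m :: int where y: "y \<in> carrier G" and m: "x \<otimes> y = c 1 [^] m \<otimes> (y \<otimes> x)"
    by blast
  have "inv y \<otimes> x = inv y \<otimes> (x \<otimes> y) \<otimes> inv y"
    using x y by (simp add: m_assoc)
  also have "\<dots> = inv y \<otimes> c 1 [^] m \<otimes> (y \<otimes> x) \<otimes> inv y"
    using x y by (simp add: m m_assoc)
  also have "\<dots> = c 1 [^] m \<otimes> (inv y \<otimes> (y \<otimes> x)) \<otimes> inv y"
    using x y c_central[of "inv y" m] by (simp add: mult_inv_cancel flip: m_assoc)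
  also have "\<dots> = c 1 [^] m \<otimes> (x \<otimes> inv y)"
    using x y by (simp add: mult_inv_cancel m_assoc)
  finally have "c 1 [^] (- m) \<otimes> (inv y \<otimes> x) = x \<otimes> inv y"
    using x y by (simp add: int_pow_neg mult_inv_cancel)
  then show "inv y \<in> ?S"
    using y by (metis (mono_tags, lifting) inv_closed mem_Collect_eq)
next
  fix y z assume "y \<in> ?S" "z \<in> ?S"
  then obtain m n :: int where
    y: "y \<in> carrier G" and m: "x \<otimes> y = c 1 [^] m \<otimes> (y \<otimes> x)" and
    z: "z \<in> carrier G" and n: "x \<otimes> z = c 1 [^] n \<otimes> (z \<otimes> x)"
    by blast
  have "x \<otimes> (y \<otimes> z) = c 1 [^] m \<otimes> (y \<otimes> (x \<otimes> z))"
    using x y z m by (metis int_pow_closed c_closed m_assoc m_closed)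
  also have "\<dots> = c 1 [^] m \<otimes> (y \<otimes> c 1 [^] n \<otimes> (z \<otimes> x))"
    using x y z by (simp add: n m_assoc)
  also have "\<dots> = c 1 [^] (m + n) \<otimes> (y \<otimes> z \<otimes> x)"
    using x y z by (simp only: c_central[OF y]) (simp add: int_pow_mult m_assoc)
  finally show "y \<otimes> z \<in> ?S"
    using y z by blast
qed blast

lemma word_commutes_mod_c:
  obtains m :: int where
    "letter_val G a l \<otimes> word_val G a L = c 1 [^] m \<otimes> (word_val G a L \<otimes> letter_val G a l)"
proof -
  define y where "y = word_val G a L"
  have y: "y \<in> carrier G"
    by (simp add: y_def)
  \<comment> \<open>The subgroup lemma is used twice: first a generator \<open>a i\<close> is fixed and the word varies, then
    the word is fixed and \<open>a i\<close> is replaced by a letter, which may be an inverse.\<close>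
  have "a i \<in> {x \<in> carrier G. \<exists>m :: int. y \<otimes> x = c 1 [^] m \<otimes> (x \<otimes> y)}" for i
  proof -
    have "a i \<otimes> a j = c 1 [^] d (i - j) \<otimes> (a j \<otimes> a i)" for j
      using a_a[of i j] by (simp flip: c_power)
    then have "range a \<subseteq> {y \<in> carrier G. \<exists>m :: int. a i \<otimes> y = c 1 [^] m \<otimes> (y \<otimes> a i)}"
      by auto
    from word_val_in_subgroup[OF commuting_mod_c_subgroup[OF a_closed] this]
    obtain m :: int where m: "a i \<otimes> y = c 1 [^] m \<otimes> (y \<otimes> a i)"
      by (auto simp: y_def)
    then have "y \<otimes> a i = c 1 [^] (- m) \<otimes> (a i \<otimes> y)"
      using y by (simp add: int_pow_neg mult_inv_cancel)
    then show ?thesis by auto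
  qed
  then have "range a \<subseteq> {x \<in> carrier G. \<exists>m :: int. y \<otimes> x = c 1 [^] m \<otimes> (x \<otimes> y)}"
    by blast
  from word_val_in_subgroup[OF commuting_mod_c_subgroup[OF y] this, of "[l]"]
  obtain m :: int where m: "y \<otimes> letter_val G a l = c 1 [^] m \<otimes> (letter_val G a l \<otimes> y)"
    by auto
  have "letter_val G a l \<otimes> y = c 1 [^] (- m) \<otimes> (y \<otimes> letter_val G a l)"
    using y by (simp add: m int_pow_neg mult_inv_cancel)
  then show thesis
    using that by (simp add: y_def)
qed

lemma word_sum_sign:
  assumes "(\<not> b, i) \<notin> set L"
  shows "if b then 0 \<le> word_sum (\<lambda>j. if j = i then 1 else 0) L
    else word_sum (\<lambda>j. if j = i then 1 else 0) L \<le> 0"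
  using assms by (induction L) (auto split: if_splits)

text \<open>
  Modulo \<open>c 1\<close> the \<open>a i\<close> commute, so a word with vanishing exponent sums collapses. The induction
  removes the first letter together with a later inverse of it, at the price of a power of \<open>c 1\<close>;
  this avoids any ordering of the letters.
\<close>
lemma balanced_word_in_c:
  assumes "\<And>i. word_sum (\<lambda>j. if j = i then 1 else 0) L = 0"
  shows "\<exists>m :: int. word_val G a L = c 1 [^] m"
  using assms
proof (induction "length L" arbitrary: L rule: less_induct)
  case less
  show ?case
  proof (cases L)
    case Nil
    then have "word_val G a L = c 1 [^] (0 :: int)" by simp
    then show ?thesis by blast
  next
    case (Cons l L')
    obtain b i where l: "l = (b, i)" by (cases l)
    \<comment> \<open>If the first letter had no inverse further on, its exponent sum would not vanish.\<close>
    have "(\<not> b, i) \<in> set L'"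
    proof (rule ccontr)
      assume "(\<not> b, i) \<notin> set L'"
      from word_sum_sign[OF this] less.prems[of i] show False
        by (simp add: Cons l split: if_splits)
    qed
    then obtain L1 L2 where L': "L' = L1 @ (\<not> b, i) # L2"
      by (meson split_list)
    have "word_sum (\<lambda>j. if j = i' then 1 else 0) (L1 @ L2) = 0" for i'
      using less.prems[of i'] by (simp add: Cons l L' split: if_splits)
    then obtain n :: int where n: "word_val G a (L1 @ L2) = c 1 [^] n"
      using less.hyps[of "L1 @ L2"] by (auto simp: Cons L')
    obtain m :: int where m: "letter_val G a l \<otimes> word_val G a L1 =
        c 1 [^] m \<otimes> (word_val G a L1 \<otimes> letter_val G a l)"
      by (rule word_commutes_mod_c)
    have "word_val G a L = letter_val G a l \<otimes> word_val G a L1 \<otimes> (inv (letter_val G a l) \<otimes> word_val G a L2)"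
      by (simp add: Cons L' l word_val_append letter_val_not m_assoc)
    also have "\<dots> = c 1 [^] m \<otimes> (word_val G a L1 \<otimes> (letter_val G a l \<otimes> inv (letter_val G a l)) \<otimes> word_val G a L2)"
      by (simp only: m) (simp add: m_assoc mult_inv_cancel)
    also have "\<dots> = c 1 [^] (m + n)"
      using n by (simp add: int_pow_mult word_val_append)
    finally show ?thesis by blast
  qed
qed

end

section \<open>Permutation groups\<close>
lemma restrict_in_BijGroup:
  assumes "f \<in> X \<rightarrow> X" "g \<in> X \<rightarrow> X" "\<And>x. x \<in> X \<Longrightarrow> g (f x) = x" "\<And>x. x \<in> X \<Longrightarrow> f (g x) = x"
  shows "restrict f X \<in> carrier (BijGroup X)"
proof -
  have "bij_betw (restrict f X) X X"
    by (rule bij_betw_byWitness[where f' = g]) (use assms in \<open>auto simp: Pi_iff\<close>)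
  then show ?thesis
    by (simp add: BijGroup_def Bij_def)
qed

lemma BijGroup_mult_apply:
  assumes "f \<in> carrier (BijGroup X)" "g \<in> carrier (BijGroup X)" "p \<in> X"
  shows "(f \<otimes>\<^bsub>BijGroup X\<^esub> g) p = f (g p)"
  using assms by (simp add: BijGroup_def compose_def)

lemma BijGroup_apply_closed: "f \<in> carrier (BijGroup X) \<Longrightarrow> p \<in> X \<Longrightarrow> f p \<in> X"
  by (auto simp: BijGroup_def dest: Bij_imp_funcset)

lemma BijGroup_eqI:
  assumes "f \<in> carrier (BijGroup X)" "g \<in> carrier (BijGroup X)" "\<And>p. p \<in> X \<Longrightarrow> f p = g p"
  shows "f = g"
  using assms by (auto simp: BijGroup_def dest!: Bij_imp_extensional intro: extensionalityI)

lemma BijGroup_apply_inv: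
  assumes "f \<in> carrier (BijGroup X)" "p \<in> X"
  shows "f ((inv\<^bsub>BijGroup X\<^esub> f) p) = p"
proof -
  interpret B: group "BijGroup X" by (rule group_BijGroup)
  have "f ((inv\<^bsub>BijGroup X\<^esub> f) p) = (f \<otimes>\<^bsub>BijGroup X\<^esub> inv\<^bsub>BijGroup X\<^esub> f) p"
    using assms by (intro BijGroup_mult_apply[symmetric]) auto
  also have "\<dots> = p"
    unfolding B.r_inv[OF assms(1)] using assms(2) by (simp add: BijGroup_def)
  finally show ?thesis .
qed

lemma finite_carrier_BijGroup:
  assumes "finite X"
  shows "finite (carrier (BijGroup X))"
proof (rule finite_subset)
  show "carrier (BijGroup X) \<subseteq> X \<rightarrow>\<^sub>E X"
    by (auto simp: BijGroup_def PiE_def dest: Bij_imp_extensional Bij_imp_funcset)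
  show "finite (X \<rightarrow>\<^sub>E X)"
    using assms by (intro finite_PiE)
qed

text \<open>
  This computes integer powers of an explicitly given permutation without computing its inverse.
\<close>
lemma (in group) additive_family_eq_int_pow:
  fixes f :: "int \<Rightarrow> 'a"
  assumes closed: "\<And>k. f k \<in> carrier G" and add: "\<And>k l. f (k + l) = f k \<otimes> f l"
  shows "f k = f 1 [^] k"
proof -
  have "f 0 \<otimes> f 0 = f 0"
    using add[of 0 0] by simp
  then have 0: "f 0 = \<one>"
    using closed l_cancel_one' by metis
  show ?thesis
  proof (induction k rule: int_induct[of _ 0])
    case base
    show ?case by (simp add: 0)
  next
    case (step1 k)
    then show ?case
      using closed by (simp add: add int_pow_mult)
  next
    case (step2 k)
    have "f (k - 1) \<otimes> f 1 = f k"
      using add[of "k - 1" 1] by simp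
    then have "f (k - 1) = f k \<otimes> inv (f 1)"
      using closed by (metis inv_solve_right)
    then show ?case
      using closed step2.IH by (simp add: int_pow_diff)
  qed
qed

section \<open>Actions on periodic functions\<close>
lemma periodic_eq_mod:
  fixes u :: "int \<Rightarrow> 'b"
  assumes "\<And>n. u (n + I) = u n"
  shows "u n = u (n mod I)"
proof -
  have "u (m + k * I) = u m" for m k
  proof (induction k rule: int_induct[of _ 0])
    case (step1 k)
    then show ?case
      using assms[of "m + k * I"] by (simp add: algebra_simps)
  next
    case (step2 k)
    then show ?case
      using assms[of "m + (k - 1) * I"] by (simp add: algebra_simps)
  qed simp
  from this[of "n mod I" "n div I"] show ?thesis
    by simp
qed

text \<open>
  The pairs of an \<open>I\<close>-periodic function into the integers modulo \<open>q\<close> and an integer modulo \<open>q\<close>, with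
  residues represented by the fixed points of \<open>x \<mapsto> x mod q\<close>. Since \<open>x mod 0 = x\<close>, the choice
  \<open>q = I = 0\<close> gives all pairs of a function \<open>\<int> \<rightarrow> \<int>\<close> and an integer.
\<close>
definition states :: "int \<Rightarrow> int \<Rightarrow> ((int \<Rightarrow> int) \<times> int) set"
  where "states q I = {(u, z). (\<forall>n. u (n + I) = u n) \<and> (\<forall>n. u n mod q = u n) \<and> z mod q = z}"

lemma finite_states:
  assumes "q > 0" "I > 0"
  shows "finite (states q I)"
proof (rule finite_imageD)
  let ?F = "\<lambda>(u, z). (restrict u {0..<I}, z)"
  have bound: "x mod q = x \<Longrightarrow> x \<in> {0..<q}" for x
    using assms by (metis atLeastLessThan_iff pos_mod_bound pos_mod_sign)
  have "?F ` states q I \<subseteq> ({0..<I} \<rightarrow>\<^sub>E {0..<q}) \<times> {0..<q}"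
    using bound by (auto simp: states_def simp del: atLeastLessThan_iff)
  then show "finite (?F ` states q I)"
    by (rule finite_subset) (simp add: finite_PiE)
  show "inj_on ?F (states q I)"
  proof (rule inj_onI, clarsimp simp: states_def)
    fix u v :: "int \<Rightarrow> int"
    assume u: "\<forall>n. u (n + I) = u n" and v: "\<forall>n. v (n + I) = v n"
      and uv: "restrict u {0..<I} = restrict v {0..<I}"
    show "u = v"
    proof
      fix n
      have "n mod I \<in> {0..<I}"
        using assms by simp
      with uv have "u (n mod I) = v (n mod I)"
        by (metis restrict_apply')
      then show "u n = v n"
        using periodic_eq_mod[of u I n] periodic_eq_mod[of v I n] u v by simp
    qed
  qed
qed

text \<open>
  Let \<open>t\<close> shift the function \<open>u\<close>, and let \<open>a i\<close> add the shifted function \<open>e (\<cdot> - i)\<close> to \<open>u\<close> and the old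
  value \<open>u i\<close> to \<open>z\<close>. The \<open>a i\<close> act as in the Heisenberg group of the bilinear form with matrix
  \<open>e (i - j)\<close>, where an element \<open>\<Sum>j. v j a j\<close> of the underlying module enters only through the functional
  \<open>u n = \<Sum>j. v j e (n - j)\<close> that it defines; so no sums have to be handled. Permuting \<open>a i\<close> and \<open>a j\<close>
  changes \<open>z\<close> by \<open>e (i - j) - e (j - i)\<close>, and if this is \<open>\<kappa> * d (i - j)\<close>, then the relations of \<open>G\<^sub>d\<close>
  hold with \<open>c i\<close> translating \<open>z\<close> by \<open>\<kappa> * d i\<close>.

  Antisymmetry of \<open>d\<close> makes \<open>e = d\<close> admissible with \<open>\<kappa> = 2\<close>; in this action the powers of \<open>c 1\<close> are
  visible. The indicator function \<open>e\<close> of the multiples of \<open>I\<close> is even and has \<open>\<kappa> = 0\<close>; it gives the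
  action of the lamplighter group \<open>\<int>/q \<wr> \<int>/I\<close> on \<open>u\<close>.
\<close>
locale gd_action =
  fixes d e :: "int \<Rightarrow> int" and q I \<kappa> :: int
  assumes d1: "d 1 = 1"
    and e_periodic: "e (n + I) mod q = e n mod q"
    and e_antisymmetrization: "(e n - e (- n)) mod q = \<kappa> * d n mod q"
begin

abbreviation X where "X \<equiv> states q I"
abbreviation B where "B \<equiv> BijGroup X"

definition t_perm where "t_perm k = (\<lambda>(u, z)\<in>X. (\<lambda>n. u (n - k), z))"
definition a_perm where
  "a_perm i = (\<lambda>(u, z)\<in>X. (\<lambda>n. (u n + e (n - i)) mod q, (z + u i) mod q))"
definition c_perm where "c_perm k = (\<lambda>(u, z)\<in>X. (u, (z + k) mod q))"

lemma periodic_shift: "e (n + I - i) mod q = e (n - i) mod q"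
  using e_periodic[of "n - i"] by (simp add: algebra_simps)

lemma t_perm_closed [simp]: "t_perm k \<in> carrier B"
  unfolding t_perm_def
proof (rule restrict_in_BijGroup[where g = "\<lambda>(u, z). (\<lambda>n. u (n + k), z)"])
  have "u (n + k + I) = u (n + k)" "u (n + I - k) = u (n - k)" if "\<forall>n. u (n + I) = u n"
    for u :: "int \<Rightarrow> int" and n
    using that[rule_format, of "n + k"] that[rule_format, of "n - k"] by (simp_all add: algebra_simps)
  then show "(\<lambda>(u, z). (\<lambda>n. u (n - k), z)) \<in> X \<rightarrow> X" "(\<lambda>(u, z). (\<lambda>n. u (n + k), z)) \<in> X \<rightarrow> X"
    by (auto simp: states_def algebra_simps)
qed auto

lemma c_perm_closed [simp]: "c_perm k \<in> carrier B"
  unfolding c_perm_def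
  by (rule restrict_in_BijGroup[where g = "\<lambda>(u, z). (u, (z - k) mod q)"])
    (auto simp: states_def mod_simps)

lemma a_perm_closed [simp]: "a_perm i \<in> carrier B"
  unfolding a_perm_def
proof (rule restrict_in_BijGroup[where
      g = "\<lambda>(u, z). (\<lambda>n. (u n - e (n - i)) mod q, (z - (u i - e 0)) mod q)"])
  \<comment> \<open>The inverse first recovers the old value of \<open>u i\<close>, which is \<open>u i - e 0\<close>, and then subtracts it.\<close>
  have "(x + e (n + I - i)) mod q = (x + e (n - i)) mod q"
    "(x - e (n + I - i)) mod q = (x - e (n - i)) mod q" for x n
    using periodic_shift[of n i] mod_add_cong mod_diff_cong by blast+
  then show "(\<lambda>(u, z). (\<lambda>n. (u n + e (n - i)) mod q, (z + u i) mod q)) \<in> X \<rightarrow> X"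
    "(\<lambda>(u, z). (\<lambda>n. (u n - e (n - i)) mod q, (z - (u i - e 0)) mod q)) \<in> X \<rightarrow> X"
    by (auto simp: states_def)
  have "(x + y - ((y + e 0) mod q - e 0)) mod q = x mod q" for x y
    using mod_diff_right_eq[of "x + y + e 0" "y + e 0" q] by (simp add: algebra_simps)
  then show "(\<lambda>(u, z). (\<lambda>n. (u n - e (n - i)) mod q, (z - (u i - e 0)) mod q))
      ((\<lambda>(u, z). (\<lambda>n. (u n + e (n - i)) mod q, (z + u i) mod q)) p) = p" if "p \<in> X" for p
    using that by (auto simp: states_def mod_simps)
qed (auto simp: states_def mod_simps)

lemma t_perm_apply: "(u, z) \<in> X \<Longrightarrow> t_perm k (u, z) = (\<lambda>n. u (n - k), z)"
  by (simp add: t_perm_def)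

lemma a_perm_apply:
  "(u, z) \<in> X \<Longrightarrow> a_perm i (u, z) = (\<lambda>n. (u n + e (n - i)) mod q, (z + u i) mod q)"
  by (simp add: a_perm_def)

lemma c_perm_apply: "(u, z) \<in> X \<Longrightarrow> c_perm k (u, z) = (u, (z + k) mod q)"
  by (simp add: c_perm_def)

sublocale B: group B
  by (rule group_BijGroup)

lemma B_eqI:
  assumes "f \<in> carrier B" "g \<in> carrier B" "\<And>u z. (u, z) \<in> X \<Longrightarrow> f (u, z) = g (u, z)"
  shows "f = g"
  using assms by (intro BijGroup_eqI[of f X g]) auto

lemma t_perm_in: "(u, z) \<in> X \<Longrightarrow> (\<lambda>n. u (n - k), z) \<in> X"
  using BijGroup_apply_closed[OF t_perm_closed] t_perm_apply by metis

lemma a_perm_in: "(u, z) \<in> X \<Longrightarrow> (\<lambda>n. (u n + e (n - i)) mod q, (z + u i) mod q) \<in> X"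
  using BijGroup_apply_closed[OF a_perm_closed] a_perm_apply by metis

lemma c_perm_in: "(u, z) \<in> X \<Longrightarrow> (u, (z + k) mod q) \<in> X"
  using BijGroup_apply_closed[OF c_perm_closed] c_perm_apply by metis

lemmas perm_simps = BijGroup_mult_apply t_perm_apply a_perm_apply c_perm_apply
  t_perm_in a_perm_in c_perm_in

lemma t_perm_eq_power: "t_perm k = t_perm 1 [^]\<^bsub>B\<^esub> k"
  by (rule B.additive_family_eq_int_pow) (auto intro!: B_eqI simp: perm_simps algebra_simps)

lemma c_perm_eq_power: "c_perm (k * j) = c_perm k [^]\<^bsub>B\<^esub> j"
proof -
  have "c_perm (k * (i + j)) = c_perm (k * i) \<otimes>\<^bsub>B\<^esub> c_perm (k * j)" for i j
    by (auto intro!: B_eqI simp: perm_simps mod_simps algebra_simps)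
  from B.additive_family_eq_int_pow[of "\<lambda>j. c_perm (k * j)", OF c_perm_closed this] show ?thesis
    by simp
qed

lemma a_perm_a_perm_apply:
  assumes "(u, z) \<in> X"
  shows "a_perm i (a_perm j (u, z)) =
    (\<lambda>n. (u n + (e (n - i) + e (n - j))) mod q, (z + (u i + u j + e (i - j))) mod q)"
  unfolding a_perm_apply[OF assms] a_perm_apply[OF a_perm_in[OF assms]]
  by (simp add: mod_simps) (simp add: algebra_simps)

lemma gd_system_B: "gd_system B (t_perm 1) a_perm (\<lambda>i. c_perm (\<kappa> * d i)) d"
proof
  show "a_perm i \<otimes>\<^bsub>B\<^esub> a_perm j = c_perm (\<kappa> * d (i - j)) \<otimes>\<^bsub>B\<^esub> (a_perm j \<otimes>\<^bsub>B\<^esub> a_perm i)" for i j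
  proof (rule B_eqI)
    fix u z assume uz: "(u, z) \<in> X"
    have "(e (i - j) - e (j - i)) mod q = \<kappa> * d (i - j) mod q"
      using e_antisymmetrization[of "i - j"] by simp
    then have "(z + u i + u j + e (j - i) + (e (i - j) - e (j - i))) mod q =
        (z + u i + u j + e (j - i) + \<kappa> * d (i - j)) mod q"
      using mod_add_cong by blast
    then have z: "(z + (u i + u j + e (i - j))) mod q =
        (z + (u j + u i + e (j - i)) + \<kappa> * d (i - j)) mod q"
      by (simp add: algebra_simps)
    have "a_perm j (a_perm i (u, z)) \<in> X"
      using uz by (simp add: BijGroup_apply_closed)
    then have "c_perm k (a_perm j (a_perm i (u, z))) =
        (\<lambda>n. (u n + (e (n - j) + e (n - i))) mod q, (z + (u j + u i + e (j - i)) + k) mod q)" for k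
      by (simp add: a_perm_a_perm_apply[OF uz] c_perm_apply mod_simps)
    then show "(a_perm i \<otimes>\<^bsub>B\<^esub> a_perm j) (u, z) =
        (c_perm (\<kappa> * d (i - j)) \<otimes>\<^bsub>B\<^esub> (a_perm j \<otimes>\<^bsub>B\<^esub> a_perm i)) (u, z)"
      using uz z by (simp add: BijGroup_mult_apply a_perm_a_perm_apply add.commute[of "e (_ - i)"])
  qed simp_all
  show "c_perm (\<kappa> * d i) = c_perm (\<kappa> * d 1) [^]\<^bsub>B\<^esub> d i" for i
    using c_perm_eq_power[of \<kappa> "d i"] by (simp add: d1)
qed (auto intro!: B_eqI simp: perm_simps mod_simps algebra_simps)

text \<open>
  Only the effect on the function \<open>u\<close> is recorded; the value \<open>z\<close> depends on the order of the letters
  and matters only for powers of \<open>c 1\<close>.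
\<close>
lemma word_val_apply:
  assumes "(u, z) \<in> X"
  shows "fst (word_val B a_perm L (u, z)) = (\<lambda>n. (u n + word_sum (\<lambda>i. e (n - i)) L) mod q)"
proof (induction L)
  case Nil
  have "u n mod q = u n" for n
    using assms by (simp add: states_def)
  then show ?case
    using assms by (simp add: BijGroup_def)
next
  case (Cons l L)
  interpret S: gd_system B "t_perm 1" a_perm "\<lambda>i. c_perm (\<kappa> * d i)" d
    by (rule gd_system_B)
  obtain b i where l: "l = (b, i)" by (cases l)
  obtain u' z' where uz': "word_val B a_perm L (u, z) = (u', z')"
    by (cases "word_val B a_perm L (u, z)")
  have X': "(u', z') \<in> X"
    using BijGroup_apply_closed[of "word_val B a_perm L" X "(u, z)"] assms uz' by simp
  have u': "u' = (\<lambda>n. (u n + word_sum (\<lambda>i. e (n - i)) L) mod q)"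
    using Cons.IH uz' by simp
  have "fst (letter_val B a_perm (b, i) (u', z')) = (\<lambda>n. (u' n + (if b then e (n - i) else - e (n - i))) mod q)"
  proof (cases b)
    case True
    then show ?thesis
      using X' by (simp add: letter_val_def a_perm_apply)
  next
    case False
    obtain v y where vy: "(inv\<^bsub>B\<^esub> a_perm i) (u', z') = (v, y)"
      by (cases "(inv\<^bsub>B\<^esub> a_perm i) (u', z')")
    have vyX: "(v, y) \<in> X"
      using BijGroup_apply_closed[of "inv\<^bsub>B\<^esub> a_perm i" X "(u', z')"] X' vy by simp
    have "a_perm i (v, y) = (u', z')"
      using BijGroup_apply_inv[OF a_perm_closed X', of i] vy by simp
    then have "u' = (\<lambda>n. (v n + e (n - i)) mod q)"
      using vyX by (simp add: a_perm_apply)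
    moreover have "v n mod q = v n" for n
      using vyX by (simp add: states_def)
    ultimately have "v = (\<lambda>n. (u' n - e (n - i)) mod q)"
      by (simp add: mod_simps)
    then show ?thesis
      using False vy by (simp add: letter_val_def)
  qed
  then show ?case
    using assms by (simp add: BijGroup_mult_apply l uz' u' mod_simps algebra_simps)
qed

end

section \<open>The universal property of \<open>G\<^sub>d\<close>\<close>
abbreviation "G_d_t d \<equiv> word_class (gd_relations d) t_word"
abbreviation "G_d_a d \<equiv> \<lambda>i. word_class (gd_relations d) (a_word i)"
abbreviation "G_d_c d \<equiv> \<lambda>i. word_class (gd_relations d) (c_word i)"

lemma gd_generated_G_d: "gd_generated (G_d d) (G_d_t d) (G_d_a d) (G_d_c d) d"
proof -
  let ?f = "\<lambda>x. word_class (gd_relations d) (gen x)"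
  have letters: "gd_letters (?f gen_t) (\<lambda>i. ?f (gen_a i)) (\<lambda>i. ?f (gen_c i)) = ?f"
    by (rule ext) (simp split: gd_gen.split)
  have word_val: "word_val (G_d d) ?f w = word_class (gd_relations d) w" for w
    unfolding G_d_def by (rule word_class_eq_word_val[symmetric])
  have "range ?f \<subseteq> carrier (G_d d)"
    by (auto simp: G_d_def carrier_presented_group)
  moreover have "word_class (gd_relations d) u = word_class (gd_relations d) v"
    if "(u, v) \<in> gd_relations d" for u v
    using that by (simp add: word_class_eq_iff word_eq.relation)
  ultimately have "gd_system (G_d d) (?f gen_t) (\<lambda>i. ?f (gen_a i)) (\<lambda>i. ?f (gen_c i)) d"
    unfolding gd_system_iff letters word_val using group_presented_group[of "gd_relations d"]
    by (auto simp: G_d_def)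
  then show ?thesis
    unfolding gd_generated_def gd_generated_axioms_def letters word_val
    by (auto simp: G_d_def carrier_presented_group)
qed

text \<open>
  By this property an element is shown to be nontrivial by evaluating it in any group that satisfies
  the relations.
\<close>
lemma G_d_lift:
  assumes "gd_system H t a c d"
  obtains h where "h \<in> hom (G_d d) H" "h (G_d_t d) = t" "h \<circ> G_d_a d = a" "h \<circ> G_d_c d = c"
proof -
  interpret gd_system H t a c d by fact
  have rel: "word_val H (gd_letters t a c) u = word_val H (gd_letters t a c) v"
    if "(u, v) \<in> gd_relations d" for u v
    using assms that unfolding gd_system_iff by blast
  obtain h where "h \<in> hom (presented_group (gd_relations d)) H"
    and h: "\<And>w. h (word_class (gd_relations d) w) = word_val H (gd_letters t a c) w"
    using presented_group_lift[OF range_letters rel] by blast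
  then have "h \<in> hom (G_d d) H"
    by (simp add: G_d_def)
  moreover have "h (G_d_t d) = t" "h \<circ> G_d_a d = a" "h \<circ> G_d_c d = c"
    by (auto simp: h)
  ultimately show thesis by (rule that)
qed

context gd_action
begin

lemma G_d_action:
  "\<exists>h\<in>hom (G_d d) B. \<forall>L k m u z. (u, z) \<in> X \<longrightarrow>
    h (word_val (G_d d) (G_d_a d) L \<otimes>\<^bsub>G_d d\<^esub> G_d_t d [^]\<^bsub>G_d d\<^esub> (k :: int)
        \<otimes>\<^bsub>G_d d\<^esub> G_d_c d 1 [^]\<^bsub>G_d d\<^esub> (m :: int)) (u, z) =
    word_val B a_perm L (\<lambda>n. u (n - k), (z + \<kappa> * m) mod q)"
proof -
  interpret G: gd_generated "G_d d" "G_d_t d" "G_d_a d" "G_d_c d" d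
    by (rule gd_generated_G_d)
  interpret S: gd_system B "t_perm 1" a_perm "\<lambda>i. c_perm (\<kappa> * d i)" d
    by (rule gd_system_B)
  obtain h where h: "h \<in> hom (G_d d) B" and h_t: "h (G_d_t d) = t_perm 1"
    and h_a: "h \<circ> G_d_a d = a_perm" and h_c: "h \<circ> G_d_c d = (\<lambda>i. c_perm (\<kappa> * d i))"
    using G_d_lift[OF gd_system_B] .
  have h_c1: "h (G_d_c d 1) = c_perm \<kappa>"
    using fun_cong[OF h_c, of 1] by (simp add: d1)
  have word: "h (word_val (G_d d) (G_d_a d) L) = word_val B a_perm L" for L
    using hom_word_val[OF h G.is_group B.is_group G.range_a] h_a by simp
  have power: "h (x [^]\<^bsub>G_d d\<^esub> k) = h x [^]\<^bsub>B\<^esub> k" if "x \<in> carrier (G_d d)" for x and k :: int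
    using hom_int_pow[OF h that G.is_group B.is_group] .
  have "h (word_val (G_d d) (G_d_a d) L \<otimes>\<^bsub>G_d d\<^esub> G_d_t d [^]\<^bsub>G_d d\<^esub> k
      \<otimes>\<^bsub>G_d d\<^esub> G_d_c d 1 [^]\<^bsub>G_d d\<^esub> m) =
    word_val B a_perm L \<otimes>\<^bsub>B\<^esub> t_perm k \<otimes>\<^bsub>B\<^esub> c_perm (\<kappa> * m)" for L and k m :: int
    by (simp add: hom_mult[OF h] word power h_t h_c1 flip: t_perm_eq_power c_perm_eq_power)
  then have "h (word_val (G_d d) (G_d_a d) L \<otimes>\<^bsub>G_d d\<^esub> G_d_t d [^]\<^bsub>G_d d\<^esub> k
      \<otimes>\<^bsub>G_d d\<^esub> G_d_c d 1 [^]\<^bsub>G_d d\<^esub> m) (u, z) =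
      word_val B a_perm L (\<lambda>n. u (n - k), (z + \<kappa> * m) mod q)"
    if "(u, z) \<in> X" for L k m u z
    using that by (simp add: perm_simps)
  with h show ?thesis by blast
qed

end

section \<open>The finite residual\<close>
definition finite_residual :: "('a, 'b) monoid_scheme \<Rightarrow> 'a set"
  where "finite_residual G = {x \<in> carrier G. \<forall>N. N \<lhd> G \<and> finite (carrier (G Mod N)) \<longrightarrow> x \<in> N}"

lemma residually_finite_iff:
  assumes "group G"
  shows "residually_finite G \<longleftrightarrow> finite_residual G \<subseteq> {\<one>\<^bsub>G\<^esub>}"
proof -
  interpret group G by fact
  have "N #>\<^bsub>G\<^esub> x = \<one>\<^bsub>G Mod N\<^esub> \<longleftrightarrow> x \<in> N" if "N \<lhd> G" "x \<in> carrier G" for N x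
    using that coset_join1[of N x] coset_join2[of x N] normal_imp_subgroup[of N G]
    by (auto simp: FactGroup_def)
  then have "residually_finite G \<longleftrightarrow>
      (\<forall>x\<in>carrier G. x \<noteq> \<one>\<^bsub>G\<^esub> \<longrightarrow> (\<exists>N. N \<lhd> G \<and> finite (carrier (G Mod N)) \<and> x \<notin> N))"
    unfolding residually_finite_def by meson
  also have "\<dots> \<longleftrightarrow> finite_residual G \<subseteq> {\<one>\<^bsub>G\<^esub>}"
    unfolding finite_residual_def by blast
  finally show ?thesis .
qed

text \<open>
  The kernel of a homomorphism into a finite group has finite index.
\<close>
lemma finite_residual_hom:
  assumes "h \<in> hom G H" "group G" "group H" "finite (carrier H)" "x \<in> finite_residual G"
  shows "h x = \<one>\<^bsub>H\<^esub>"
proof -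
  interpret group_hom G H h
    using assms by (simp add: group_hom_def group_hom_axioms_def)
  have "(\<lambda>Y. the_elem (h ` Y)) ` carrier (G Mod kernel G H h) \<subseteq> carrier H"
    using FactGroup_the_elem_mem by blast
  then have "finite (carrier (G Mod kernel G H h))"
    using FactGroup_inj_on assms(4) by (meson finite_imageD finite_subset)
  then have "x \<in> kernel G H h"
    using assms(5) normal_kernel by (simp add: finite_residual_def)
  then show ?thesis
    by (simp add: kernel_def)
qed

section \<open>Finite quotients force periodicity\<close>
lemma gd_system_hom_image:
  assumes "gd_system G t a c d" "h \<in> hom G H" "group H"
  shows "gd_system H (h t) (h \<circ> a) (h \<circ> c) d"
proof -
  interpret G: gd_system G t a c d by fact
  interpret group_hom G H h
    using assms by (simp add: group_hom_def group_hom_axioms_def G.is_group)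
  have letters: "gd_letters (h t) (h \<circ> a) (h \<circ> c) = h \<circ> gd_letters t a c"
    by (rule ext) (simp split: gd_gen.split)
  have "word_val H (h \<circ> gd_letters t a c) u = word_val H (h \<circ> gd_letters t a c) v"
    if "(u, v) \<in> gd_relations d" for u v
  proof -
    have "word_val G (gd_letters t a c) u = word_val G (gd_letters t a c) v"
      using assms(1) that unfolding gd_system_iff by blast
    then show ?thesis
      by (simp only: hom_word_val[OF assms(2) G.is_group assms(3) G.range_letters, symmetric])
  qed
  moreover have "range (h \<circ> gd_letters t a c) \<subseteq> carrier H"
    using G.range_letters by (auto simp: image_subset_iff)
  ultimately show ?thesis
    unfolding gd_system_iff letters using assms(3) by auto
qed

text \<open>
  The period is the order of \<open>t\<close>: as \<open>t\<close> shifts the \<open>a i\<close>, they repeat with this period, and therefore so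
  do the commutators \<open>c n\<close> of \<open>a n\<close> with \<open>a 0\<close>.
\<close>
lemma (in gd_system) periodic_mod_ord_c:
  assumes "finite (carrier G)"
  shows "periodic_mod d (int (ord (c 1)))"
proof -
  define I where "I = int (ord t)"
  have "I \<ge> 1"
    using ord_ge_1[OF assms t_closed] by (simp add: I_def)
  have "t [^] I = \<one>"
    by (simp add: I_def int_pow_int)
  then have a_periodic: "a (i + I) = a i" for i
    using t_power_a[of I i] by simp
  have "[d (n + I) = d n] (mod int (ord (c 1)))" for n
  proof -
    have "c (n + I) \<otimes> (a 0 \<otimes> a n) = c n \<otimes> (a 0 \<otimes> a n)"
      using a_a[of "n + I" 0, symmetric] a_a[of n 0] by (simp add: a_periodic)
    then have "c (n + I) = c n"
      by simp
    then have "c 1 [^] d (n + I) = c 1 [^] d n"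
      by (simp only: c_power[symmetric])
    then have "int (ord (c 1)) dvd d n - d (n + I)"
      by (simp add: int_pow_eq)
    then show ?thesis
      by (simp add: cong_iff_dvd_diff dvd_diff_commute)
  qed
  with \<open>I \<ge> 1\<close> show ?thesis
    unfolding periodic_mod_def by blast
qed

text \<open>
  The element \<open>c 1\<close> has infinite order because it translates \<open>z\<close> by 2 in the action with \<open>q = I = 0\<close>,
  that is, on functions \<open>\<int> \<rightarrow> \<int>\<close> and integers without any reduction.
\<close>
lemma c_power_nontrivial:
  fixes m :: int
  assumes antisymmetric: "\<forall>i. d (- i) = - d i" and "d 1 = 1" and "m \<noteq> 0"
  shows "G_d_c d 1 [^]\<^bsub>G_d d\<^esub> m \<noteq> \<one>\<^bsub>G_d d\<^esub>"
proof
  assume c: "G_d_c d 1 [^]\<^bsub>G_d d\<^esub> m = \<one>\<^bsub>G_d d\<^esub>"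
  interpret gd_action d d 0 0 2
    by unfold_locales (use assms in simp_all)
  interpret G: gd_generated "G_d d" "G_d_t d" "G_d_a d" "G_d_c d" d
    by (rule gd_generated_G_d)
  obtain h where h: "h \<in> hom (G_d d) B"
    and apply_h: "\<And>L k m u z. (u, z) \<in> X \<Longrightarrow>
      h (word_val (G_d d) (G_d_a d) L \<otimes>\<^bsub>G_d d\<^esub> G_d_t d [^]\<^bsub>G_d d\<^esub> (k :: int)
          \<otimes>\<^bsub>G_d d\<^esub> G_d_c d 1 [^]\<^bsub>G_d d\<^esub> (m :: int)) (u, z) =
      word_val B a_perm L (\<lambda>n. u (n - k), (z + 2 * m) mod 0)"
    using G_d_action by blast
  have X: "((\<lambda>_. 0), z) \<in> X" for z
    by (simp add: states_def)
  have "h \<one>\<^bsub>G_d d\<^esub> ((\<lambda>_. 0), 0) = ((\<lambda>_. 0), 2 * m)"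
    using apply_h[OF X, of "[]" 0 m 0] X by (simp add: c BijGroup_def)
  moreover have "h \<one>\<^bsub>G_d d\<^esub> ((\<lambda>_. 0), 0) = ((\<lambda>_. 0), 0)"
    using hom_one[OF h G.is_group B.is_group] X by (simp add: BijGroup_def)
  ultimately show False
    using \<open>m \<noteq> 0\<close> by simp
qed

text \<open>
  If there were only finitely many moduli, the power of \<open>c 1\<close> with exponent their product would be
  trivial in every finite quotient, because the order of \<open>c 1\<close> there is one of them.
\<close>
lemma infinite_moduli_if_residually_finite:
  assumes antisymmetric: "\<forall>i. d (- i) = - d i" and "d 1 = 1" and "residually_finite (G_d d)"
  shows "infinite {q :: int. q > 0 \<and> periodic_mod d q}"
proof
  interpret G: gd_generated "G_d d" "G_d_t d" "G_d_a d" "G_d_c d" d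
    by (rule gd_generated_G_d)
  assume finite: "finite {q :: int. q > 0 \<and> periodic_mod d q}"
  define m where "m = \<Prod> {q :: int. q > 0 \<and> periodic_mod d q}"
  have "m \<noteq> 0"
    using finite by (simp add: m_def)
  from c_power_nontrivial[OF assms(1,2) this]
  have "G_d_c d 1 [^]\<^bsub>G_d d\<^esub> m \<notin> finite_residual (G_d d)"
    using assms(3) residually_finite_iff[OF G.is_group] by auto
  then obtain N where N: "N \<lhd> G_d d" "finite (carrier (G_d d Mod N))"
    and c_N: "G_d_c d 1 [^]\<^bsub>G_d d\<^esub> m \<notin> N"
    by (auto simp: finite_residual_def)
  define h where "h x = N #>\<^bsub>G_d d\<^esub> x" for x
  have Q: "group (G_d d Mod N)"
    by (rule normal.factorgroup_is_group[OF N(1)])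
  have h: "h \<in> hom (G_d d) (G_d d Mod N)"
    unfolding h_def by (rule normal.r_coset_hom_Mod[OF N(1)])
  interpret Q: gd_system "G_d d Mod N" "h (G_d_t d)" "h \<circ> G_d_a d" "h \<circ> G_d_c d" d
    by (rule gd_system_hom_image[OF G.gd_system_axioms h Q])
  define q where "q = int (Q.ord (h (G_d_c d 1)))"
  have c1: "h (G_d_c d 1) \<in> carrier (G_d d Mod N)"
    using Q.c_closed[of 1] by simp
  have "q > 0"
    using Q.ord_ge_1[OF N(2) c1] by (simp add: q_def)
  moreover have "periodic_mod d q"
    using Q.periodic_mod_ord_c[OF N(2)] by (simp add: q_def)
  ultimately have "q dvd m"
    unfolding m_def using finite by (intro dvd_prodI) auto
  then have "h (G_d_c d 1) [^]\<^bsub>G_d d Mod N\<^esub> m = \<one>\<^bsub>G_d d Mod N\<^esub>"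
    using Q.int_pow_eq_id[OF c1] by (simp add: q_def)
  then have "N #>\<^bsub>G_d d\<^esub> G_d_c d 1 [^]\<^bsub>G_d d\<^esub> m = N"
    using hom_int_pow[OF h G.c_closed G.is_group Q] by (simp add: h_def FactGroup_def)
  from G.coset_join1[OF this _ normal_imp_subgroup[OF N(1)]] c_N show False
    by simp
qed

section \<open>Periodicity gives enough finite quotients\<close>
lemma (in gd_action) finite_residual_acts_trivially:
  assumes "q > 0" "I > 0"
    and x: "word_val (G_d d) (G_d_a d) L \<otimes>\<^bsub>G_d d\<^esub> G_d_t d [^]\<^bsub>G_d d\<^esub> (k :: int)
        \<otimes>\<^bsub>G_d d\<^esub> G_d_c d 1 [^]\<^bsub>G_d d\<^esub> (m :: int) \<in> finite_residual (G_d d)"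
    and uz: "(u, z) \<in> X"
  shows "word_val B a_perm L (\<lambda>n. u (n - k), (z + \<kappa> * m) mod q) = (u, z)"
proof -
  interpret G: gd_generated "G_d d" "G_d_t d" "G_d_a d" "G_d_c d" d
    by (rule gd_generated_G_d)
  obtain h where h: "h \<in> hom (G_d d) B"
    and apply_h: "\<And>L k m u z. (u, z) \<in> X \<Longrightarrow>
      h (word_val (G_d d) (G_d_a d) L \<otimes>\<^bsub>G_d d\<^esub> G_d_t d [^]\<^bsub>G_d d\<^esub> (k :: int)
          \<otimes>\<^bsub>G_d d\<^esub> G_d_c d 1 [^]\<^bsub>G_d d\<^esub> (m :: int)) (u, z) =
      word_val B a_perm L (\<lambda>n. u (n - k), (z + \<kappa> * m) mod q)"
    using G_d_action by blast
  have "finite (carrier B)"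
    using assms(1,2) by (intro finite_carrier_BijGroup finite_states)
  from finite_residual_hom[OF h G.is_group B.is_group this x] show ?thesis
    using apply_h[OF uz, of L k m] uz by (simp add: BijGroup_def)
qed

lemma (in gd_action) finite_residual_shift:
  assumes "q > 0" "I > 0"
    and x: "word_val (G_d d) (G_d_a d) L \<otimes>\<^bsub>G_d d\<^esub> G_d_t d [^]\<^bsub>G_d d\<^esub> (k :: int)
        \<otimes>\<^bsub>G_d d\<^esub> G_d_c d 1 [^]\<^bsub>G_d d\<^esub> (m :: int) \<in> finite_residual (G_d d)"
    and uz: "(u, z) \<in> X"
  shows "(u (n - k) + word_sum (\<lambda>i. e (n - i)) L) mod q = u n"
proof -
  have "(\<lambda>n. u (n - k), (z + \<kappa> * m) mod q) \<in> X"
    using c_perm_in[OF t_perm_in[OF uz]] .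
  from word_val_apply[OF this, of L] finite_residual_acts_trivially[OF assms]
  have "u = (\<lambda>n. (u (n - k) + word_sum (\<lambda>i. e (n - i)) L) mod q)"
    by simp
  then show ?thesis
    by metis
qed

text \<open>
  The lamplighter action: the indicator function is even, so the images of the \<open>a i\<close> commute and \<open>c 1\<close>
  acts trivially. It exists for all \<open>q\<close> and \<open>I\<close>.
\<close>
lemma gd_action_lamp:
  assumes "d 1 = 1"
  shows "gd_action d (\<lambda>n. if I dvd n then 1 else 0) q I 0"
  by unfold_locales (use assms in auto)

context
  fixes d :: "int \<Rightarrow> int" and L :: "int word" and k m :: int
  assumes d1: "d 1 = 1"
    and x: "word_val (G_d d) (G_d_a d) L \<otimes>\<^bsub>G_d d\<^esub> G_d_t d [^]\<^bsub>G_d d\<^esub> k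
        \<otimes>\<^bsub>G_d d\<^esub> G_d_c d 1 [^]\<^bsub>G_d d\<^esub> m \<in> finite_residual (G_d d)"
begin

text \<open>
  Acting on the zero function shows that the \<open>a\<close>-part is invisible at the index 0; then acting on the
  indicator function of the multiples of \<open>I\<close> shows that this function is shifted by \<open>k\<close> to a function
  with the same value at 0. Any \<open>I > \<bar>k\<bar>\<close> turns this into \<open>k = 0\<close>.
\<close>
lemma finite_residual_t_exponent: "k = 0"
proof -
  define I where "I = \<bar>k\<bar> + 1"
  interpret gd_action d "\<lambda>n. if I dvd n then 1 else 0" 2 I 0
    using d1 by (rule gd_action_lamp)
  have "I > 0"
    by (simp add: I_def)
  have 0: "((\<lambda>_. 0), 0) \<in> X" and indicator: "(\<lambda>n. if I dvd n then 1 else 0, 0) \<in> X"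
    by (auto simp: states_def)
  have "word_sum (\<lambda>i. if I dvd 0 - i then 1 else 0) L mod 2 = 0"
    using finite_residual_shift[OF _ \<open>I > 0\<close> x 0, of 0] by simp
  moreover have "((if I dvd 0 - k then 1 else 0) + word_sum (\<lambda>i. if I dvd 0 - i then 1 else 0) L) mod 2 = 1"
    using finite_residual_shift[OF _ \<open>I > 0\<close> x indicator, of 0] by simp
  ultimately have "I dvd k"
    by (simp split: if_splits)
  then show "k = 0"
    using dvd_imp_le_int[of k I] by (auto simp: I_def)
qed

text \<open>
  The period \<open>I\<close> exceeds all distances from \<open>j\<close> to the indices in \<open>L\<close>, so that reduction modulo \<open>I\<close> mixes
  no other exponent with that of \<open>a j\<close>; the modulus exceeds the absolute value of the
  exponent sum \<open>s\<close> that is to vanish.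
\<close>
lemma finite_residual_a_exponents: "word_sum (\<lambda>i. if i = j then 1 else 0) L = 0"
proof -
  define s where "s = word_sum (\<lambda>i. if i = j then 1 else 0) L"
  define I where "I = 1 + (\<Sum>i\<in>snd ` set L. \<bar>j - i\<bar>)"
  interpret gd_action d "\<lambda>n. if I dvd n then 1 else 0" "\<bar>s\<bar> + 1" I 0
    using d1 by (rule gd_action_lamp)
  have "I > 0"
    unfolding I_def by (simp add: add_pos_nonneg sum_nonneg)
  have "word_sum (\<lambda>i. if I dvd j - i then 1 else 0) L = s"
    unfolding s_def
  proof (rule word_sum_cong)
    fix i assume "i \<in> snd ` set L"
    then have "\<bar>j - i\<bar> < I"
      unfolding I_def using member_le_sum[of i "snd ` set L" "\<lambda>i. \<bar>j - i\<bar>"] by simp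
    then have "I dvd j - i \<longleftrightarrow> i = j"
      using dvd_imp_le_int[of "j - i" I] \<open>I > 0\<close> by auto
    then show "(if I dvd j - i then 1 else 0 :: int) = (if i = j then 1 else 0)"
      by simp
  qed
  moreover have "((\<lambda>_. 0), 0) \<in> X"
    by (simp add: states_def)
  from finite_residual_shift[OF _ \<open>I > 0\<close> x this, of j]
  have "word_sum (\<lambda>i. if I dvd j - i then 1 else 0) L mod (\<bar>s\<bar> + 1) = 0"
    by simp
  ultimately have "\<bar>s\<bar> + 1 dvd s"
    by (simp add: dvd_eq_mod_eq_0)
  then show ?thesis
    using dvd_imp_le_int[of s "\<bar>s\<bar> + 1"] by (auto simp: s_def)
qed

end

text \<open>
  Here periodicity enters: a period \<open>I\<close> of \<open>d\<close> modulo \<open>q\<close> makes \<open>e = d\<close> admissible, and \<open>c 1\<close> to the power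
  \<open>m\<close> translates \<open>z\<close> by \<open>2 * m\<close>, which for \<open>m \<noteq> 0\<close> is not zero modulo any \<open>q > \<bar>2 * m\<bar>\<close>.
\<close>
lemma finite_residual_c_power:
  fixes m :: int
  assumes antisymmetric: "\<forall>i. d (- i) = - d i" and "d 1 = 1"
    and infinite: "infinite {q :: int. q > 0 \<and> periodic_mod d q}"
    and x: "G_d_c d 1 [^]\<^bsub>G_d d\<^esub> m \<in> finite_residual (G_d d)"
  shows "m = 0"
proof (rule ccontr)
  assume "m \<noteq> 0"
  have "\<not> {q :: int. q > 0 \<and> periodic_mod d q} \<subseteq> {0..\<bar>2 * m\<bar>}"
    using infinite finite_subset by blast
  then obtain q where "q > 0" "periodic_mod d q" "q \<notin> {0..\<bar>2 * m\<bar>}"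
    by blast
  then have q: "periodic_mod d q" "q > \<bar>2 * m\<bar>"
    by auto
  then obtain I where "I \<ge> 1" and I: "\<And>n. [d (n + I) = d n] (mod q)"
    by (auto simp: periodic_mod_def)
  interpret gd_action d d q I 2
    by unfold_locales (use assms I in \<open>simp_all add: cong_def\<close>)
  interpret G: gd_generated "G_d d" "G_d_t d" "G_d_a d" "G_d_c d" d
    by (rule gd_generated_G_d)
  have X: "((\<lambda>_. 0), 0) \<in> X"
    by (simp add: states_def)
  have "q > 0" "I > 0"
    using q \<open>I \<ge> 1\<close> by auto
  moreover have "word_val (G_d d) (G_d_a d) [] \<otimes>\<^bsub>G_d d\<^esub> G_d_t d [^]\<^bsub>G_d d\<^esub> (0 :: int)
      \<otimes>\<^bsub>G_d d\<^esub> G_d_c d 1 [^]\<^bsub>G_d d\<^esub> m \<in> finite_residual (G_d d)"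
    using x by simp
  ultimately have "word_val B a_perm [] (\<lambda>n. 0, (0 + 2 * m) mod q) = ((\<lambda>_. 0), 0)"
    using finite_residual_acts_trivially[OF _ _ _ X] by blast
  moreover have "((\<lambda>n. 0), (0 + 2 * m) mod q) \<in> X"
    by (rule c_perm_in[OF X])
  ultimately have "q dvd 2 * m"
    by (auto simp: BijGroup_def)
  then show False
    using dvd_imp_le_int[of "2 * m" q] q \<open>m \<noteq> 0\<close> by auto
qed

theorem proposition4p2:
  fixes d :: "int \<Rightarrow> int"
  assumes antisymmetric: "\<forall>i. d (- i) = - d i"
    and "d 1 = 1"
  shows "residually_finite (G_d d) \<longleftrightarrow> infinite {q :: int. q > 0 \<and> periodic_mod d q}"
proof
  assume "residually_finite (G_d d)"
  then show "infinite {q :: int. q > 0 \<and> periodic_mod d q}"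
    by (rule infinite_moduli_if_residually_finite[OF assms])
next
  assume infinite: "infinite {q :: int. q > 0 \<and> periodic_mod d q}"
  interpret G: gd_generated "G_d d" "G_d_t d" "G_d_a d" "G_d_c d" d
    by (rule gd_generated_G_d)
  have "x = \<one>\<^bsub>G_d d\<^esub>" if x: "x \<in> finite_residual (G_d d)" for x
  proof -
    obtain L and k m :: int where Lkm: "x = word_val (G_d d) (G_d_a d) L
        \<otimes>\<^bsub>G_d d\<^esub> G_d_t d [^]\<^bsub>G_d d\<^esub> k \<otimes>\<^bsub>G_d d\<^esub> G_d_c d 1 [^]\<^bsub>G_d d\<^esub> m"
      using G.normal_form x unfolding finite_residual_def by blast
    have "k = 0" "\<And>j. word_sum (\<lambda>i. if i = j then 1 else 0) L = 0"
      using finite_residual_t_exponent finite_residual_a_exponents \<open>d 1 = 1\<close> x Lkm by blast+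
    moreover from this obtain n :: int
      where "word_val (G_d d) (G_d_a d) L = G_d_c d 1 [^]\<^bsub>G_d d\<^esub> n"
      using G.balanced_word_in_c by blast
    ultimately have x_c: "x = G_d_c d 1 [^]\<^bsub>G_d d\<^esub> (n + m)"
      by (simp add: Lkm G.int_pow_mult)
    then have "n + m = 0"
      using finite_residual_c_power[OF assms infinite] x by blast
    then show ?thesis
      by (simp add: x_c)
  qed
  then show "residually_finite (G_d d)"
    using residually_finite_iff[OF G.is_group] by blast
qed

end
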